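(* Let $\Omega,U,H,L,\mathcal{M}_0$ be as in the context, under assumptions (H1), (H2), (H3), (H4) and (A1) listed there, and let $u^\gamma$ ($\gamma\in\mathbb{R}$) be the functions defined there. If $\langle\mu,(-x)\cdot D_xL(x,v)\rangle=c^{(1)}$ for all $\mu\in\mathcal{M}_0$ (with $c^{(1)}$ a constant), then $$u^\gamma(\cdot)+\gamma c^{(1)}=u^0(\cdot)\qquad(\gamma\in\mathbb{R}).$$
   Context: $\Omega\subset\mathbb{R}^n$ is open, bounded, connected, with $0\in\Omega$. $U=B(0,R_0)$ is an open ball with $2\Omega\subseteq U$, and $H:\overline U\times\mathbb{R}^n\to\mathbb{R}$ is continuous. The Lagrangian is $L(x,v)=\sup_{p\in\mathbb{R}^n}(p\cdot v-H(x,p))$, $(x,v)\in\overline U\times\mathbb{R}^n$. Assumptions: (H1) for each $R>0$ there is $C_R$ with $|H(x,p)-H(y,p)|\le C_R|x-y|$ and $|H(x,p)-H(x,q)|\le C_R|p-q|$ for $x,y\in\overline U$, $|p|,|q|\le R$; (H2) $\lim_{|p|\to\infty}\min_{x\in\overline U}H(x,p)=+\infty$; (H3) $p\mapsto H(x,p)$ is convex for each $x\in\overline U$; (H4) for $v\in\mathbb{R}^n$, $x\mapsto L(x,v)$ is continuously differentiable on $\overline U$; (A1) $\Omega$ is star-shaped with respect to the origin and there is $\kappa>0$ such that $\mathrm{dist}(x,\overline\Omega)\ge\kappa s$ for all $s>0$ and $x\in(1+s)\partial\Omega$. $c(0)=\inf\{c\in\mathbb{R}:H(x,Dv)\le c\text{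 has a viscosity subsolution in }\Omega\}$ is the additive eigenvalue of $H$ in $\Omega$. Normalization (made without loss of generality; not an additional restriction on $H$): the solutions considered satisfy an a priori gradient bound $|Du|\le C_H$ with $C_H$ depending only on $H$, so the values of $H(x,p)$ for large $|p|$ are irrelevant; after modifying $H$ for large $|p|$ one may assume that there is $h>0$ such that $H(x,p)=\sup_{|v|\le h}(p\cdot v-L(x,v))$ for $(x,p)\in\overline\Omega\times\mathbb{R}^n$ and $L(x,v)=\sup_{p}(p\cdot v-H(x,p))$ for $(x,v)\in\overline\Omega\times\overline B_h$, with $L\in C(\overline\Omega\times\overline B_h)$, where $\overline B_h$ is the closed ball of radius $h$ at $0$ in $\mathbb{R}^n$. The measures below are defined with this normalization. Viscosity Mather measures: for $f\in C(\overline\Omega\times\overline B_h)$ put $H_f(x,p)=\max_{|v|\le h}(p\cdot v-f(x,v))$. Let $\mathcal{G}_{0,\Omega}$ be the set of $f\in C(\overline\Omega\times\overline B_h)$ for which there is $u\in C(\overline\Omega)$ that is a viscosity subsolution of $H_f(x,Du)\le0$ in $\Omega$. For a Radon measure $\mu$ on $\overline\Omega\times\overline B_h$ write $\langle\mu,f\rangle=\int f\,d\mu$ (functions of $x$ alone are viewed as functions of $(x,v)$), and let $\mathcal{G}'_{0,\Omega}$ be the set of Radon measures with $\langle\mu,f\rangle\ge0$ for all $f\in\mathcal{G}_{0,\Omega}$. $\mathcal{M}_0$ is the set of probability measures $\mu\in\mathcal{G}'_{0,\Omega}$ with $\langle\mu,L\rangle=-c(0)$ (the minimum of $\langle\mu,L\rangle$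 over probability measures in $\mathcal{G}'_{0,\Omega}$). For $\gamma\in\mathbb{R}$ (including $\gamma=0$), $\mathcal{E}^\gamma$ is the family of viscosity subsolutions $w\in C(\overline\Omega)$ of $H(x,Dw)\le c(0)$ in $\Omega$ with $\gamma\langle\mu,(-x)\cdot D_xL(x,v)\rangle+\langle\mu,w\rangle\le0$ for all $\mu\in\mathcal{M}_0$, and $u^\gamma=\sup_{w\in\mathcal{E}^\gamma}w$. *)

theory Defs
  imports "HOL-Probability.Probability"
begin

definition C1_on :: "'a::euclidean_space set \<Rightarrow> ('a \<Rightarrow> real) \<Rightarrow> ('a \<Rightarrow> 'a) \<Rightarrow> bool" where
  "C1_on S f g \<longleftrightarrow>
     (\<forall>x\<in>S. (f has_derivative (\<lambda>d. g x \<bullet> d)) (at x within S)) \<and> continuous_on S g"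

definition gradient_within :: "'a::euclidean_space set \<Rightarrow> ('a \<Rightarrow> real) \<Rightarrow> 'a \<Rightarrow> 'a" where
  "gradient_within S f x = (THE g. (f has_derivative (\<lambda>d. g \<bullet> d)) (at x within S))"

text \<open>Continuous viscosity subsolutions of \<open>F(x, Du) \<le> c\<close> in an open set \<open>\<Omega>\<close>.\<close>

definition viscosity_subsolution ::
  "'a::euclidean_space set \<Rightarrow> ('a \<Rightarrow> 'a \<Rightarrow> real) \<Rightarrow> real \<Rightarrow> ('a \<Rightarrow> real) \<Rightarrow> bool" where
  "viscosity_subsolution \<Omega> F c u \<longleftrightarrow>
     continuous_on \<Omega> u \<and>
     (\<forall>\<phi> g x. C1_on \<Omega> \<phi> g \<and> x \<in> \<Omega> \<and> (\<forall>\<^sub>F y in at x. u y - \<phi> y \<le> u x - \<phi> x)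
        \<longrightarrow> F x (g x) \<le> c)"

definition additive_eigenvalue :: "'a::euclidean_space set \<Rightarrow> ('a \<Rightarrow> 'a \<Rightarrow> real) \<Rightarrow> real" where
  "additive_eigenvalue \<Omega> H = Inf {c. \<exists>v. viscosity_subsolution \<Omega> H c v}"

definition lagrangian :: "('a::euclidean_space \<Rightarrow> 'a \<Rightarrow> real) \<Rightarrow> 'a \<Rightarrow> 'a \<Rightarrow> real" where
  "lagrangian H x v = (SUP p. p \<bullet> v - H x p)"

definition H1 :: "'a::euclidean_space set \<Rightarrow> ('a \<Rightarrow> 'a \<Rightarrow> real) \<Rightarrow> bool" where
  "H1 U H \<longleftrightarrow> (\<forall>R>0. \<exists>C. \<forall>x\<in>closure U. \<forall>y\<in>closure U. \<forall>p q. norm p \<le> R \<longrightarrow> norm q \<le> R \<longrightarrow>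
     \<bar>H x p - H y p\<bar> \<le> C * norm (x - y) \<and> \<bar>H x p - H x q\<bar> \<le> C * norm (p - q))"

definition H2 :: "'a::euclidean_space set \<Rightarrow> ('a \<Rightarrow> 'a \<Rightarrow> real) \<Rightarrow> bool" where
  "H2 U H \<longleftrightarrow> filterlim (\<lambda>p. INF x\<in>closure U. H x p) at_top at_infinity"

definition H3 :: "'a::euclidean_space set \<Rightarrow> ('a \<Rightarrow> 'a \<Rightarrow> real) \<Rightarrow> bool" where
  "H3 U H \<longleftrightarrow> (\<forall>x\<in>closure U. convex_on UNIV (H x))"

text \<open>Differentiability of \<open>L(\<cdot>, v)\<close> presupposes that \<open>L(x, v)\<close> is finite; as the supremum in
  \<^const>\<open>lagrangian\<close> is taken in the reals, this has to be said explicitly.\<close>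

definition H4 :: "'a::euclidean_space set \<Rightarrow> ('a \<Rightarrow> 'a \<Rightarrow> real) \<Rightarrow> bool" where
  "H4 U H \<longleftrightarrow> (\<forall>v. (\<forall>x\<in>closure U. bdd_above (range (\<lambda>p. p \<bullet> v - H x p))) \<and>
     (\<exists>g. C1_on (closure U) (\<lambda>x. lagrangian H x v) g))"

definition A1 :: "'a::euclidean_space set \<Rightarrow> bool" where
  "A1 \<Omega> \<longleftrightarrow> (\<forall>x\<in>\<Omega>. closed_segment 0 x \<subseteq> \<Omega>) \<and>
     (\<exists>\<kappa>>0. \<forall>s>0. \<forall>x\<in>(\<lambda>y. (1 + s) *\<^sub>R y) ` frontier \<Omega>. infdist x (closure \<Omega>) \<ge> \<kappa> * s)"

text \<open>\<open>h\<close> is an admissible radius for the velocities: \<open>H\<close> can be modified outside a ball that contains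
  all momenta \<open>p\<close> with \<open>H(x, p) \<le> c(0)\<close>, hence all gradients of subsolutions of \<open>H(x, Du) \<le> c(0)\<close>,
  such that the modified Hamiltonian \<open>K\<close> and the Lagrangian \<open>L\<close> restricted to the closed ball of
  radius \<open>h\<close> are conjugate to each other. This is a condition on \<open>h\<close> and not on \<open>H\<close>: the
  Hamiltonian \<open>H\<close> itself grows superlinearly by \<open>(H4)\<close>, while \<open>K\<close> grows linearly, and for large
  \<open>h\<close> the function \<open>K(x, p) = max {p \<bullet> v - L(x, v) | \<bar>v\<bar> \<le> h}\<close> is such a modification.\<close>

definition normalizing_radius ::
  "'a::euclidean_space set \<Rightarrow> ('a \<Rightarrow> 'a \<Rightarrow> real) \<Rightarrow> real \<Rightarrow> bool" where
  "normalizing_radius \<Omega> H h \<longleftrightarrow> h > 0 \<and>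
     continuous_on (closure \<Omega> \<times> cball 0 h) (\<lambda>(x, v). lagrangian H x v) \<and>
     (\<exists>C K. \<forall>x\<in>closure \<Omega>.
        (\<forall>p. H x p \<le> additive_eigenvalue \<Omega> H \<longrightarrow> norm p \<le> C) \<and>
        (\<forall>p. norm p \<le> C \<longrightarrow> K x p = H x p) \<and>
        (\<forall>p. K x p = (SUP v\<in>cball 0 h. p \<bullet> v - lagrangian H x v)) \<and>
        (\<forall>v\<in>cball 0 h. lagrangian H x v = (SUP p. p \<bullet> v - K x p)))"

definition hamiltonian_of ::
  "real \<Rightarrow> ('a::euclidean_space \<times> 'a \<Rightarrow> real) \<Rightarrow> 'a \<Rightarrow> 'a \<Rightarrow> real" where
  "hamiltonian_of h f x p = (SUP v\<in>cball 0 h. p \<bullet> v - f (x, v))"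

definition G0 :: "'a::euclidean_space set \<Rightarrow> real \<Rightarrow> ('a \<times> 'a \<Rightarrow> real) set" where
  "G0 \<Omega> h = {f. continuous_on (closure \<Omega> \<times> cball 0 h) f \<and>
     (\<exists>u. continuous_on (closure \<Omega>) u \<and> viscosity_subsolution \<Omega> (hamiltonian_of h f) 0 u)}"

text \<open>The Radon measures on the compact set \<open>closure \<Omega> \<times> cball 0 h\<close> are its finite Borel measures.
  Nothing is lost by not admitting signed measures: \<^const>\<open>G0\<close> is a cone and closed under adding
  nonnegative continuous functions, so any element of its dual cone is nonnegative.\<close>

definition G0' :: "'a::euclidean_space set \<Rightarrow> real \<Rightarrow> ('a \<times> 'a) measure set" where
  "G0' \<Omega> h = {\<mu>. sets \<mu> = sets (restrict_space borel (closure \<Omega> \<times> cball 0 h)) \<and>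
     finite_measure \<mu> \<and> (\<forall>f\<in>G0 \<Omega> h. (\<integral>z. f z \<partial>\<mu>) \<ge> 0)}"

definition mather_measures ::
  "'a::euclidean_space set \<Rightarrow> ('a \<Rightarrow> 'a \<Rightarrow> real) \<Rightarrow> real \<Rightarrow> ('a \<times> 'a) measure set" where
  "mather_measures \<Omega> H h = {\<mu> \<in> G0' \<Omega> h. prob_space \<mu> \<and>
     (\<integral>(x, v). lagrangian H x v \<partial>\<mu>) = - additive_eigenvalue \<Omega> H}"

definition pairing_DxL ::
  "'a::euclidean_space set \<Rightarrow> ('a \<Rightarrow> 'a \<Rightarrow> real) \<Rightarrow> ('a \<times> 'a) measure \<Rightarrow> real" where
  "pairing_DxL U H \<mu> =
     (\<integral>(x, v). (- x) \<bullet> gradient_within (closure U) (\<lambda>y. lagrangian H y v) x \<partial>\<mu>)"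

definition E_family ::
  "'a::euclidean_space set \<Rightarrow> 'a set \<Rightarrow> ('a \<Rightarrow> 'a \<Rightarrow> real) \<Rightarrow> real \<Rightarrow> real \<Rightarrow> ('a \<Rightarrow> real) set" where
  "E_family \<Omega> U H h \<gamma> = {w. continuous_on (closure \<Omega>) w \<and>
     viscosity_subsolution \<Omega> H (additive_eigenvalue \<Omega> H) w \<and>
     (\<forall>\<mu>\<in>mather_measures \<Omega> H h. \<gamma> * pairing_DxL U H \<mu> + (\<integral>(x, v). w x \<partial>\<mu>) \<le> 0)}"

definition u_sup ::
  "'a::euclidean_space set \<Rightarrow> 'a set \<Rightarrow> ('a \<Rightarrow> 'a \<Rightarrow> real) \<Rightarrow> real \<Rightarrow> real \<Rightarrow> 'a \<Rightarrow> ereal" where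
  "u_sup \<Omega> U H h \<gamma> x = (SUP w\<in>E_family \<Omega> U H h \<gamma>. ereal (w x))"

end

theory Submission
  imports Defs
begin

text \<open>When the pairing with \<open>(-x) \<bullet> D\<^sub>xL\<close> is the constant \<open>c\<^sup>(\<^sup>1\<^sup>)\<close> on all Mather measures, the
  constraint defining \<open>\<E>\<^sup>\<gamma>\<close> reads \<open>\<gamma> c\<^sup>(\<^sup>1\<^sup>) + \<langle>\<mu>, w\<rangle> \<le> 0\<close>. Since the measures have mass one and \<open>H\<close>
  does not depend on the value of the unknown, \<open>w \<mapsto> w + (\<gamma> - \<delta>) c\<^sup>(\<^sup>1\<^sup>)\<close> maps \<open>\<E>\<^sup>\<gamma>\<close> into \<open>\<E>\<^sup>\<delta>\<close> for all
  \<open>\<gamma>, \<delta>\<close>. Comparing suprema for \<open>(\<gamma>, 0)\<close> and \<open>(0, \<gamma>)\<close> gives the identity, also when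
  \<open>\<E>\<^sup>\<gamma>\<close> is empty or the supremum is infinite.\<close>

text \<open>The constant cancels in the touching condition, so \<open>u\<close> and
  \<open>u + a\<close> have the same test functions at every point.\<close>

lemma viscosity_subsolution_add_const:
  assumes "viscosity_subsolution \<Omega> F c u"
  shows "viscosity_subsolution \<Omega> F c (\<lambda>x. u x + a)"
proof -
  have "(u y + a - r \<le> u x + a - s) = (u y - r \<le> u x - s)" for x y r s
    by linarith
  with assms show ?thesis
    unfolding viscosity_subsolution_def by (auto intro!: continuous_intros)
qed

text \<open>\<open>w\<close> is bounded on the compact set \<open>S\<close> and \<open>\<mu>\<close>
  has finite mass. Integrability is what allows a constant to be split off: the integral of a
  non-integrable function is 0 by default.\<close>

lemma integrable_fst_of_continuous_on_compact:
  fixes \<mu> :: "('a::euclidean_space \<times> 'b::euclidean_space) measure" and w :: "'a \<Rightarrow> real"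
  assumes "finite_measure \<mu>" and sets: "sets \<mu> = sets (restrict_space borel (S \<times> T))"
    and "compact S" and cont: "continuous_on S w"
  shows "integrable \<mu> (\<lambda>(x, v). w x)"
proof -
  interpret finite_measure \<mu> by fact
  have space: "space \<mu> = S \<times> T"
    using sets_eq_imp_space_eq[OF sets] by (simp add: space_restrict_space)
  have "continuous_on (S \<times> T) (\<lambda>z. w (fst z))"
    by (rule continuous_on_compose2[OF cont continuous_on_fst[OF continuous_on_id]]) auto
  then have "(\<lambda>z. w (fst z)) \<in> borel_measurable \<mu>"
    using borel_measurable_continuous_on_restrict measurable_cong_sets[OF sets refl] by blast
  moreover obtain B where "\<And>x. x \<in> S \<Longrightarrow> norm (w x) \<le> B"
    using compact_imp_bounded[OF compact_continuous_image[OF cont \<open>compact S\<close>]]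
    by (auto simp: bounded_iff)
  then have "AE z in \<mu>. norm (w (fst z)) \<le> B"
    by (intro AE_I2) (auto simp: space)
  ultimately show ?thesis
    by (simp add: integrable_const_bound case_prod_unfold)
qed

lemma E_family_shift:
  assumes "bounded \<Omega>"
    and pairing: "\<And>\<mu>. \<mu> \<in> mather_measures \<Omega> H h \<Longrightarrow> pairing_DxL U H \<mu> = c1"
    and w: "w \<in> E_family \<Omega> U H h \<gamma>"
  shows "(\<lambda>x. w x + (\<gamma> - \<delta>) * c1) \<in> E_family \<Omega> U H h \<delta>"
proof -
  have cont: "continuous_on (closure \<Omega>) w"
    using w by (simp add: E_family_def)
  have "\<delta> * pairing_DxL U H \<mu> + (\<integral>(x, v). w x + (\<gamma> - \<delta>) * c1 \<partial>\<mu>) \<le> 0"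
    if \<mu>: "\<mu> \<in> mather_measures \<Omega> H h" for \<mu>
  proof -
    interpret prob_space \<mu>
      using \<mu> by (simp add: mather_measures_def)
    have "integrable \<mu> (\<lambda>(x, v). w x)"
      using \<mu> \<open>bounded \<Omega>\<close> cont finite_measure_axioms
      by (intro integrable_fst_of_continuous_on_compact[where S = "closure \<Omega>" and T = "cball 0 h"])
        (auto simp: mather_measures_def G0'_def)
    then have "(\<integral>(x, v). w x + (\<gamma> - \<delta>) * c1 \<partial>\<mu>) = (\<integral>(x, v). w x \<partial>\<mu>) + (\<gamma> - \<delta>) * c1"
      by (simp add: case_prod_unfold prob_space)
    moreover have "\<gamma> * c1 + (\<integral>(x, v). w x \<partial>\<mu>) \<le> 0"
      using w \<mu> pairing[OF \<mu>] by (auto simp: E_family_def)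
    ultimately show ?thesis
      by (simp add: pairing[OF \<mu>] algebra_simps)
  qed
  then show ?thesis
    using w by (auto simp: E_family_def viscosity_subsolution_add_const intro!: continuous_intros)
qed

lemma u_sup_shift_le:
  assumes "bounded \<Omega>"
    and "\<And>\<mu>. \<mu> \<in> mather_measures \<Omega> H h \<Longrightarrow> pairing_DxL U H \<mu> = c1"
  shows "u_sup \<Omega> U H h \<gamma> x \<le> u_sup \<Omega> U H h \<delta> x - ereal ((\<gamma> - \<delta>) * c1)"
  unfolding u_sup_def[of _ _ _ _ \<gamma>]
\<comment> \<open>Bounding each \<open>w x\<close> separately also covers an empty family, whose
  supremum is minus infinity.\<close>
proof (rule SUP_least)
  fix w assume "w \<in> E_family \<Omega> U H h \<gamma>"
  then have "(\<lambda>x. w x + (\<gamma> - \<delta>) * c1) \<in> E_family \<Omega> U H h \<delta>"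
    using E_family_shift[OF assms] by blast
  then have "ereal (w x + (\<gamma> - \<delta>) * c1) \<le> u_sup \<Omega> U H h \<delta> x"
    unfolding u_sup_def by (rule SUP_upper2) simp
  then show "ereal (w x) \<le> u_sup \<Omega> U H h \<delta> x - ereal ((\<gamma> - \<delta>) * c1)"
    by (simp add: ereal_le_minus)
qed

theorem corollary1p5:
  fixes \<Omega> U :: "(real ^ 'n) set"
    and H :: "real ^ 'n \<Rightarrow> real ^ 'n \<Rightarrow> real"
    and R\<^sub>0 h c1 :: real
  assumes "open \<Omega>" and "bounded \<Omega>" and "connected \<Omega>" and "0 \<in> \<Omega>"
    and "U = ball 0 R\<^sub>0" and "(\<lambda>x. 2 *\<^sub>R x) ` \<Omega> \<subseteq> U"
    and "continuous_on (closure U \<times> UNIV) (\<lambda>(x, p). H x p)"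
    and "H1 U H" and "H2 U H" and "H3 U H" and "H4 U H" and "A1 \<Omega>"
    and "normalizing_radius \<Omega> H h"
    and "\<forall>\<mu>\<in>mather_measures \<Omega> H h. pairing_DxL U H \<mu> = c1"
  shows "\<forall>\<gamma>. \<forall>x\<in>closure \<Omega>. u_sup \<Omega> U H h \<gamma> x + ereal (\<gamma> * c1) = u_sup \<Omega> U H h 0 x"
proof (intro allI ballI)
  fix \<gamma> x
  have le: "u_sup \<Omega> U H h \<alpha> x \<le> u_sup \<Omega> U H h \<beta> x - ereal ((\<alpha> - \<beta>) * c1)" for \<alpha> \<beta>
    using assms(2,14) by (blast intro: u_sup_shift_le)
  show "u_sup \<Omega> U H h \<gamma> x + ereal (\<gamma> * c1) = u_sup \<Omega> U H h 0 x"
    \<comment> \<open>If one value is infinite, the two bounds force the other to be the same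
      infinity; finite values agree by antisymmetry.\<close>
    using le[of \<gamma> 0] le[of 0 \<gamma>]
    by (cases "u_sup \<Omega> U H h \<gamma> x"; cases "u_sup \<Omega> U H h 0 x") auto
qed

end
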